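(* Let $n\ge 1$, let $(M,\omega)$ be a pre-$n$-plectic manifold, $\mathfrak g$ a finite-dimensional real Lie algebra and $\zeta:\mathfrak g\to\mathfrak X(M,\omega)$ an infinitesimal $n$-plectic action. Let $g=\sum_{k=1}^{n+1}g_k\in C^{n+1}$ be the $D$-cocycle with components $g_k\in\Lambda^k\mathfrak g^*\otimes\Omega^{n+1-k}(M)$ given by $$g_k(X_1,\dots,X_k)=-(-1)^{k(k+1)/2}\,\iota_{\zeta(X_k)}\cdots\iota_{\zeta(X_1)}\omega .$$ Then there is a one-to-one correspondence between homotopy co-moment maps for $\zeta$ and $D$-potentials of $g$ of the form $p=\sum_{i=1}^n p_i\in C^n$ with $p_i\in\Lambda^i\mathfrak g^*\otimes\Omega^{n-i}(M)$ (i.e. such elements $p$ with $Dp=g$).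
   Context: A pre-$n$-plectic manifold $(M,\omega)$ is a smooth manifold $M$ with a closed $(n+1)$-form $\omega$ (no non-degeneracy required). $\mathfrak X(M,\omega)=\{v\in\mathfrak X(M)\mid \mathcal L_v\omega=0\}$. An infinitesimal $n$-plectic action is a Lie algebra homomorphism $\zeta:\mathfrak g\to\mathfrak X(M)$ with image in $\mathfrak X(M,\omega)$. $\iota_v$ denotes contraction with $v$. Observables. $L=L(M,\omega)=\bigoplus_{i=-n+1}^0L_i$ with $L_i=\Omega^{n-1+i}(M)$ for $i\ne0$ and $L_0=\{(v,\alpha)\in\mathfrak X(M)\times\Omega^{n-1}(M)\mid d\alpha=-\iota_v\omega\}$; $\pi_{\mathfrak X}:L_0\to\mathfrak X(M)$ and $\pi_\Omega:L_0\to\Omega^{n-1}(M)$ are the projections. $L$ is an $L_\infty$-algebra (Lie $n$-algebra) with brackets: $l_1(\alpha)=d\alpha$ for $\alpha\in L_{-i}$, $i>1$; $l_1(\alpha)=(0,d\alpha)$ for $\alpha\in L_{-1}$; $l_1=0$ on $L_0$; $l_2((v,\alpha),(w,\beta))=([v,w],\iota_w\iota_v\omega)$; $l_k((v_1,\alpha_1),\dots,(v_k,\alpha_k))=-(-1)^{k(k+1)/2}\iota_{v_k}\cdots\iota_{v_1}\omega$ for $2<k\le n+1$; for $k>1$, $l_k$ vanishes when the total degree of its arguments is nonzero. Chevalley-Eilenberg differential (trivial representation), for skew-symmetric multilinear $f$ on $\mathfrak g$ with values in a vector space: $$(\delta f)(X_1,\dots,X_{k+1})=\sum_{1\le i<j\le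 k+1}(-1)^{i+j}f([X_i,X_j],X_1,\dots,\hat X_i,\dots,\hat X_j,\dots,X_{k+1}),$$ with $\delta=0$ on $\Lambda^0\mathfrak g^*$. Homotopy co-moment map for $\zeta$: an $L_\infty$-morphism $F:\mathfrak g\to L(M,\omega)$ lifting $\zeta$ along $\pi_{\mathfrak X}$. Explicitly, a family $\{f_1,\dots,f_n\}$ of skew-symmetric $k$-multilinear maps $f_k:\mathfrak g^k\to L_{1-k}$ with $\pi_{\mathfrak X}\circ f_1=\zeta$ and $\delta f_k+l_1f_{k+1}=-f_1^*l_{k+1}$ for $1\le k\le n$, where $f_{n+1}=0$ and $(f_1^*l_{k+1})(X_1,\dots,X_{k+1})=l_{k+1}(f_1(X_1),\dots,f_1(X_{k+1}))$. Total complex. $\Lambda^k\mathfrak g^*\otimes\Omega^j(M)$ is identified with the $k$-multilinear skew-symmetric maps $\mathfrak g^k\to\Omega^j(M)$; $C^k=\bigoplus_{i+j=k}\Lambda^i\mathfrak g^*\otimes\Omega^j(M)$ with $D|_{\Lambda^i\mathfrak g^*\otimes\Omega^j(M)}=\delta\otimes\mathrm{id}+(-1)^n(-1)^{i+j}(\mathrm{id}\otimes d)$, $d$ the de Rham differential. *)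

theory Defs
  imports "HOL-Analysis.Analysis" "HOL-Library.Function_Algebras"
begin

text \<open>
  Functions, vector fields, differential forms and cochains are all represented as functions, and
  all their vector space structures are pointwise.
\<close>

instantiation "fun" :: (type, real_vector) real_vector
begin

definition scaleR_fun :: "real \<Rightarrow> ('a \<Rightarrow> 'b) \<Rightarrow> 'a \<Rightarrow> 'b" where
  "scaleR_fun r f = (\<lambda>x. r *\<^sub>R f x)"

instance
  by standard (simp_all add: scaleR_fun_def plus_fun_def fun_eq_iff scaleR_add_right scaleR_add_left)

end


section \<open>Smooth manifolds\<close>

text \<open>
  \<open>Ck_on k S f\<close>: \<open>f\<close> is of class \<open>C\<^sup>k\<close> on the open subset \<open>S\<close> of a
  finite-dimensional space (all iterated directional derivatives exist and are continuous).
\<close>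

primrec Ck_on ::
  "nat \<Rightarrow> 'a::real_normed_vector set \<Rightarrow> ('a \<Rightarrow> 'b::real_normed_vector) \<Rightarrow> bool" where
  "Ck_on 0 S f \<longleftrightarrow> continuous_on S f"
| "Ck_on (Suc k) S f \<longleftrightarrow>
     (\<forall>x\<in>S. f differentiable (at x)) \<and> (\<forall>v. Ck_on k S (\<lambda>x. frechet_derivative f (at x) v))"

definition smooth_on ::
  "'a::real_normed_vector set \<Rightarrow> ('a \<Rightarrow> 'b::real_normed_vector) \<Rightarrow> bool" where
  "smooth_on S f \<longleftrightarrow> (\<forall>k. Ck_on k S f)"

text \<open>
  A manifold is given by its topology and an atlas of charts \<open>(U, \<phi>)\<close> with values in the model
  space \<open>'e\<close>. The model space is an arbitrary finite-dimensional normed space rather than a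
  \<open>euclidean_space\<close>, since the latter class excludes dimension 0.
\<close>

record ('m, 'e) manifold =
  mtop :: "'m topology"
  charts :: "('m set \<times> ('m \<Rightarrow> 'e)) set"

definition is_chart :: "'m topology \<Rightarrow> 'm set \<Rightarrow> ('m \<Rightarrow> 'e::real_normed_vector) \<Rightarrow> bool" where
  "is_chart X U \<phi> \<longleftrightarrow> openin X U \<and> open (\<phi> ` U) \<and>
     homeomorphic_map (subtopology X U) (top_of_set (\<phi> ` U)) \<phi>"

definition smooth_manifold :: "('m, 'e::real_normed_vector) manifold \<Rightarrow> bool" where
  "smooth_manifold M \<longleftrightarrow>
     (\<exists>B::'e set. finite B \<and> span B = UNIV) \<and>
     Hausdorff_space (mtop M) \<and> second_countable (mtop M) \<and>
     (\<forall>(U, \<phi>) \<in> charts M. is_chart (mtop M) U \<phi>) \<and>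
     (\<Union>(U, \<phi>) \<in> charts M. U) = topspace (mtop M) \<and>
     (\<forall>(U, \<phi>) \<in> charts M. \<forall>(V, \<psi>) \<in> charts M. smooth_on (\<phi> ` (U \<inter> V)) (\<psi> \<circ> inv_into U \<phi>))"


section \<open>Vector fields and differential forms\<close>

text \<open>Functions on the manifold are extended by 0 outside of it.\<close>

definition smooth_funs :: "('m, 'e::real_normed_vector) manifold \<Rightarrow> ('m \<Rightarrow> real) set" where
  "smooth_funs M = {f. (\<forall>x. x \<notin> topspace (mtop M) \<longrightarrow> f x = 0) \<and>
     (\<forall>(U, \<phi>) \<in> charts M. smooth_on (\<phi> ` U) (f \<circ> inv_into U \<phi>))}"

text \<open>
  As in Helgason's ``Differential Geometry, Lie Groups, and Symmetric Spaces'', vector fields are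
  the derivations of the algebra \<open>C\<^sup>\<infinity>(M)\<close> of smooth functions, and differential \<open>k\<close>-forms are
  the alternating \<open>C\<^sup>\<infinity>(M)\<close>-multilinear maps taking \<open>k\<close> vector fields to a smooth function.
  Vector fields vanish on non-smooth functions, and \<open>k\<close>-forms vanish on all lists that are not
  lists of \<open>k\<close> vector fields.
\<close>

type_synonym 'm vfield = "('m \<Rightarrow> real) \<Rightarrow> 'm \<Rightarrow> real"
type_synonym 'm dform = "'m vfield list \<Rightarrow> 'm \<Rightarrow> real"

definition vfields :: "('m, 'e::real_normed_vector) manifold \<Rightarrow> 'm vfield set" where
  "vfields M = {v.
     (\<forall>h. h \<notin> smooth_funs M \<longrightarrow> v h = 0) \<and>
     (\<forall>h \<in> smooth_funs M. v h \<in> smooth_funs M) \<and>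
     (\<forall>g \<in> smooth_funs M. \<forall>h \<in> smooth_funs M. v (g + h) = v g + v h) \<and>
     (\<forall>c. \<forall>h \<in> smooth_funs M. v (c *\<^sub>R h) = c *\<^sub>R v h) \<and>
     (\<forall>g \<in> smooth_funs M. \<forall>h \<in> smooth_funs M. v (g * h) = g * v h + h * v g)}"

definition fun_times_vf :: "('m \<Rightarrow> real) \<Rightarrow> 'm vfield \<Rightarrow> 'm vfield" where
  "fun_times_vf g v = (\<lambda>h. g * v h)"

definition vf_bracket :: "'m vfield \<Rightarrow> 'm vfield \<Rightarrow> 'm vfield" where
  "vf_bracket v w = (\<lambda>h. v (w h) - w (v h))"

definition forms :: "('m, 'e::real_normed_vector) manifold \<Rightarrow> nat \<Rightarrow> 'm dform set" where
  "forms M k = {\<alpha>.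
     (\<forall>vs. \<not> (length vs = k \<and> set vs \<subseteq> vfields M) \<longrightarrow> \<alpha> vs = 0) \<and>
     (\<forall>vs. length vs = k \<and> set vs \<subseteq> vfields M \<longrightarrow>
        \<alpha> vs \<in> smooth_funs M \<and>
        (\<forall>i<k. \<forall>v \<in> vfields M. \<forall>w \<in> vfields M.
           \<alpha> (vs[i := v + w]) = \<alpha> (vs[i := v]) + \<alpha> (vs[i := w])) \<and>
        (\<forall>i<k. \<forall>g \<in> smooth_funs M. \<forall>v \<in> vfields M.
           \<alpha> (vs[i := fun_times_vf g v]) = g * \<alpha> (vs[i := v])) \<and>
        (\<forall>j<k. \<forall>i<j. \<alpha> (vs[i := vs ! j, j := vs ! i]) = - \<alpha> vs))}"

definition omit :: "nat \<Rightarrow> 'a list \<Rightarrow> 'a list" where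
  "omit i xs = take i xs @ drop (Suc i) xs"

text \<open>
  Cartan's formula for the exterior derivative. Positions in lists are counted from 0, which does
  not affect the sign of the second sum. The degree of \<open>\<alpha>\<close> need not be specified, since a form
  vanishes on lists of the wrong length.
\<close>

definition ext_deriv :: "('m, 'e::real_normed_vector) manifold \<Rightarrow> 'm dform \<Rightarrow> 'm dform" where
  "ext_deriv M \<alpha> = (\<lambda>vs. if set vs \<subseteq> vfields M then
     (\<Sum>i<length vs. (-1) ^ i *\<^sub>R (vs ! i) (\<alpha> (omit i vs))) +
     (\<Sum>j<length vs. \<Sum>i<j.
        (-1) ^ (i + j) *\<^sub>R \<alpha> (vf_bracket (vs ! i) (vs ! j) # omit i (omit j vs)))
     else 0)"

definition contract :: "'m vfield \<Rightarrow> 'm dform \<Rightarrow> 'm dform" where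
  "contract v \<alpha> = (\<lambda>vs. \<alpha> (v # vs))"

text \<open>\<open>contract_list [v\<^sub>1, \<dots>, v\<^sub>k] \<alpha>\<close> contracts with \<open>v\<^sub>1\<close> first and with \<open>v\<^sub>k\<close> last.\<close>

definition contract_list :: "'m vfield list \<Rightarrow> 'm dform \<Rightarrow> 'm dform" where
  "contract_list vs \<alpha> = fold contract vs \<alpha>"

definition lie_deriv ::
  "('m, 'e::real_normed_vector) manifold \<Rightarrow> 'm vfield \<Rightarrow> 'm dform \<Rightarrow> 'm dform" where
  "lie_deriv M v \<alpha> = (\<lambda>vs. if set vs \<subseteq> vfields M then
     v (\<alpha> vs) - (\<Sum>i<length vs. \<alpha> (vs[i := vf_bracket v (vs ! i)])) else 0)"


section \<open>Pre-n-plectic manifolds and infinitesimal actions\<close>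

definition pre_plectic ::
  "nat \<Rightarrow> ('m, 'e::real_normed_vector) manifold \<Rightarrow> 'm dform \<Rightarrow> bool" where
  "pre_plectic n M \<omega> \<longleftrightarrow> smooth_manifold M \<and> \<omega> \<in> forms M (n + 1) \<and> ext_deriv M \<omega> = 0"

definition plectic_vfields ::
  "('m, 'e::real_normed_vector) manifold \<Rightarrow> 'm dform \<Rightarrow> 'm vfield set" where
  "plectic_vfields M \<omega> = {v \<in> vfields M. lie_deriv M v \<omega> = 0}"

definition fin_dim_lie_algebra :: "('g::real_vector \<Rightarrow> 'g \<Rightarrow> 'g) \<Rightarrow> bool" where
  "fin_dim_lie_algebra br \<longleftrightarrow>
     (\<exists>B::'g set. finite B \<and> span B = UNIV) \<and>
     bilinear br \<and> (\<forall>X. br X X = 0) \<and>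
     (\<forall>X Y Z. br X (br Y Z) + br Y (br Z X) + br Z (br X Y) = 0)"

definition plectic_action ::
  "('m, 'e::real_normed_vector) manifold \<Rightarrow> 'm dform \<Rightarrow> ('g::real_vector \<Rightarrow> 'g \<Rightarrow> 'g) \<Rightarrow>
   ('g \<Rightarrow> 'm vfield) \<Rightarrow> bool" where
  "plectic_action M \<omega> br \<zeta> \<longleftrightarrow>
     linear \<zeta> \<and> range \<zeta> \<subseteq> plectic_vfields M \<omega> \<and>
     (\<forall>X Y. \<zeta> (br X Y) = vf_bracket (\<zeta> X) (\<zeta> Y))"


section \<open>The Lie n-algebra of observables\<close>

text \<open>
  The homogeneous components are all embedded into pairs of a vector field and a form: a form
  \<open>\<alpha>\<close> of negative degree is represented by \<open>(0, \<alpha>)\<close>.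
\<close>

type_synonym 'm observable = "'m vfield \<times> 'm dform"

definition observables ::
  "nat \<Rightarrow> ('m, 'e::real_normed_vector) manifold \<Rightarrow> 'm dform \<Rightarrow> int \<Rightarrow> 'm observable set" where
  "observables n M \<omega> i =
     (if i = 0 then
        {(v, \<alpha>). v \<in> vfields M \<and> \<alpha> \<in> forms M (n - 1) \<and> ext_deriv M \<alpha> = - contract v \<omega>}
      else if 1 - int n \<le> i \<and> i < 0 then {0} \<times> forms M (nat (int n - 1 + i))
      else {0})"

text \<open>\<open>l1 M i\<close> is the unary bracket on the component of degree \<open>i\<close>.\<close>

definition l1 ::
  "('m, 'e::real_normed_vector) manifold \<Rightarrow> int \<Rightarrow> 'm observable \<Rightarrow> 'm observable" where
  "l1 M i x = (if i < 0 then (0, ext_deriv M (snd x)) else 0)"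

text \<open>
  \<open>lk n \<omega> ds xs\<close> is the bracket of arity \<open>k = length xs > 1\<close>, where \<open>ds\<close> lists the degrees of the
  homogeneous elements \<open>xs\<close>.
\<close>

definition lk :: "nat \<Rightarrow> 'm dform \<Rightarrow> int list \<Rightarrow> 'm observable list \<Rightarrow> 'm observable" where
  "lk n \<omega> ds xs = (let k = length xs in
     if sum_list ds \<noteq> 0 then 0
     else if k = 2 then
       (vf_bracket (fst (xs ! 0)) (fst (xs ! 1)), contract_list (map fst xs) \<omega>)
     else if 2 < k \<and> k \<le> n + 1 then
       (0, - ((-1) ^ (k * (k + 1) div 2) *\<^sub>R contract_list (map fst xs) \<omega>))
     else 0)"


section \<open>Cochains and homotopy co-moment maps\<close>

text \<open>
  A \<open>k\<close>-cochain with values in the linear subspace \<open>W\<close> is a skew-symmetric \<open>k\<close>-multilinear map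
  with values in \<open>W\<close>, considered as a function on lists that vanishes on lists of length \<open>\<noteq> k\<close>.
\<close>

definition cochains :: "nat \<Rightarrow> 'v set \<Rightarrow> ('g::real_vector list \<Rightarrow> 'v::real_vector) set" where
  "cochains k W = {f.
     (\<forall>Xs. length Xs \<noteq> k \<longrightarrow> f Xs = 0) \<and>
     (\<forall>Xs. length Xs = k \<longrightarrow>
        f Xs \<in> W \<and>
        (\<forall>i<k. linear (\<lambda>X. f (Xs[i := X]))) \<and>
        (\<forall>j<k. \<forall>i<j. f (Xs[i := Xs ! j, j := Xs ! i]) = - f Xs))}"

text \<open>Positions are counted from 0; this does not affect the signs.\<close>

definition ce_diff ::
  "('g::real_vector \<Rightarrow> 'g \<Rightarrow> 'g) \<Rightarrow> ('g list \<Rightarrow> 'v::real_vector) \<Rightarrow> 'g list \<Rightarrow> 'v" where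
  "ce_diff br f = (\<lambda>Xs. \<Sum>j<length Xs. \<Sum>i<j.
     (-1) ^ (i + j) *\<^sub>R f (br (Xs ! i) (Xs ! j) # omit i (omit j Xs)))"

text \<open>The family \<open>f\<^sub>1, \<dots>, f\<^sub>n\<close> is extended by 0 to all natural numbers.\<close>

definition comoment_maps ::
  "nat \<Rightarrow> ('m, 'e::real_normed_vector) manifold \<Rightarrow> 'm dform \<Rightarrow> ('g::real_vector \<Rightarrow> 'g \<Rightarrow> 'g) \<Rightarrow>
   ('g \<Rightarrow> 'm vfield) \<Rightarrow> (nat \<Rightarrow> 'g list \<Rightarrow> 'm observable) set" where
  "comoment_maps n M \<omega> br \<zeta> = {f.
     (\<forall>k. k \<notin> {1..n} \<longrightarrow> f k = 0) \<and>
     (\<forall>k \<in> {1..n}. f k \<in> cochains k (observables n M \<omega> (1 - int k))) \<and>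
     (\<forall>X. fst (f 1 [X]) = \<zeta> X) \<and>
     (\<forall>k \<in> {1..n}. \<forall>Xs. length Xs = k + 1 \<longrightarrow>
        ce_diff br (f k) Xs + l1 M (- int k) (f (k + 1) Xs) =
        - lk n \<omega> (replicate (k + 1) 0) (map (\<lambda>X. f 1 [X]) Xs))}"


section \<open>The total complex\<close>

text \<open>The \<open>i\<close>-th component of an element of degree \<open>k\<close> has bidegree \<open>(i, k - i)\<close>.\<close>

definition total_complex ::
  "('m, 'e::real_normed_vector) manifold \<Rightarrow> nat \<Rightarrow> (nat \<Rightarrow> 'g::real_vector list \<Rightarrow> 'm dform) set"
  where
  "total_complex M k = {c. (\<forall>i\<le>k. c i \<in> cochains i (forms M (k - i))) \<and> (\<forall>i>k. c i = 0)}"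

text \<open>\<open>total_diff n M br k\<close> is the differential \<open>D\<close> on the component of total degree \<open>k\<close>.\<close>

definition total_diff ::
  "nat \<Rightarrow> ('m, 'e::real_normed_vector) manifold \<Rightarrow> ('g::real_vector \<Rightarrow> 'g \<Rightarrow> 'g) \<Rightarrow> nat \<Rightarrow>
   (nat \<Rightarrow> 'g list \<Rightarrow> 'm dform) \<Rightarrow> (nat \<Rightarrow> 'g list \<Rightarrow> 'm dform)" where
  "total_diff n M br k c = (\<lambda>i.
     (if i = 0 then 0 else ce_diff br (c (i - 1))) +
     ((-1) ^ n * (-1) ^ k) *\<^sub>R (\<lambda>Xs. ext_deriv M (c i Xs)))"

definition action_cocycle ::
  "nat \<Rightarrow> 'm dform \<Rightarrow> ('g \<Rightarrow> 'm vfield) \<Rightarrow> (nat \<Rightarrow> 'g list \<Rightarrow> 'm dform)" where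
  "action_cocycle n \<omega> \<zeta> = (\<lambda>k Xs.
     if k \<in> {1..n + 1} \<and> length Xs = k
     then - ((-1) ^ (k * (k + 1) div 2) *\<^sub>R contract_list (map \<zeta> Xs) \<omega>) else 0)"

definition reduced_potentials ::
  "nat \<Rightarrow> ('m, 'e::real_normed_vector) manifold \<Rightarrow> 'm dform \<Rightarrow> ('g::real_vector \<Rightarrow> 'g \<Rightarrow> 'g) \<Rightarrow>
   ('g \<Rightarrow> 'm vfield) \<Rightarrow> (nat \<Rightarrow> 'g list \<Rightarrow> 'm dform) set" where
  "reduced_potentials n M \<omega> br \<zeta> =
     {p \<in> total_complex M n. p 0 = 0 \<and> total_diff n M br n p = action_cocycle n \<omega> \<zeta>}"

end

theory Submission
  imports Defs
begin

text \<open>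
  The correspondence sends \<open>f\<close> to \<open>p\<^sub>k = - \<pi>\<^sub>\<Omega> \<circ> f\<^sub>k\<close>. Nothing is lost by forgetting the vector
  field components, because they are prescribed: \<open>\<pi>\<^sub>\<XX> \<circ> f\<^sub>1 = \<zeta>\<close>, and \<open>f\<^sub>k\<close> takes values in
  pure forms for \<open>k \<ge> 2\<close>. So the inverse pairs \<open>-p\<close> with \<open>\<zeta>\<close>
  (\<open>lift_to_observables\<close>), and it remains to see that the conditions on both sides match.

  In total degree \<open>n\<close> the sign \<open>(-1)\<^sup>n (-1)\<^sup>n\<close> in \<open>D\<close> is 1, so that \<open>D p = g\<close> is the system of equations
  \<open>d p\<^sub>1 = g\<^sub>1\<close> and \<open>\<delta> p\<^sub>k + d p\<^sub>k\<^sub>+\<^sub>1 = g\<^sub>k\<^sub>+\<^sub>1\<close> for \<open>1 \<le> k \<le> n\<close>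
  (\<open>total_diff_eq_action_cocycle_iff\<close>). The first one reads \<open>d (- p\<^sub>1(X)) = - \<iota>\<^bsub>\<zeta>(X)\<^esub> \<omega>\<close>, which says
  exactly that the pair \<open>(\<zeta>(X), - p\<^sub>1(X))\<close> is an observable of degree 0. The other ones are
  the form components of the equations \<open>\<delta> f\<^sub>k + l\<^sub>1 f\<^sub>k\<^sub>+\<^sub>1 = - f\<^sub>1\<^sup>* l\<^sub>k\<^sub>+\<^sub>1\<close>, since \<open>g\<^sub>k\<close> is the
  form component of \<open>f\<^sub>1\<^sup>* l\<^sub>k\<close>; the vector field component of the latter is trivial for \<open>k \<ge> 2\<close>
  and for \<open>k = 1\<close> expresses that \<open>\<zeta>\<close> preserves brackets
  (\<open>morphism_equation_lift_iff\<close>).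
\<close>


section \<open>Negatives of smooth functions and of forms\<close>

text \<open>
  The iterated derivatives in \<open>Ck_on\<close> are taken at points of \<open>S\<close> without restricting to \<open>S\<close>,
  hence the congruence rule holds only for open \<open>S\<close>.
\<close>

lemma Ck_on_cong:
  assumes "open S" and "\<And>x. x \<in> S \<Longrightarrow> f x = g x" and "Ck_on k S f"
  shows "Ck_on k S g"
  using assms(2,3)
proof (induction k arbitrary: f g)
  case 0
  then show ?case by (simp cong: continuous_on_cong)
next
  case (Suc k)
  have deriv: "(g has_derivative frechet_derivative f (at x)) (at x)" if "x \<in> S" for x
    using that Suc.prems assms(1)
    by (auto intro: has_derivative_transform_within_open simp: frechet_derivative_works)
  then have "frechet_derivative f (at x) = frechet_derivative g (at x)" if "x \<in> S" for x
    using that by (simp add: frechet_derivative_at)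
  then have "Ck_on k S (\<lambda>x. frechet_derivative g (at x) v)" for v
    using Suc.IH[of "\<lambda>x. frechet_derivative f (at x) v" "\<lambda>x. frechet_derivative g (at x) v"]
      Suc.prems(2) by simp
  with deriv show ?case by (auto simp: differentiable_def)
qed

lemma Ck_on_uminus:
  assumes "open S" and "Ck_on k S f"
  shows "Ck_on k S (\<lambda>x. - f x)"
  using assms(2)
proof (induction k arbitrary: f)
  case 0
  then show ?case by (simp add: continuous_on_minus)
next
  case (Suc k)
  have deriv: "((\<lambda>x. - f x) has_derivative (\<lambda>v. - frechet_derivative f (at x) v)) (at x)"
    if "x \<in> S" for x
    using that Suc.prems by (auto intro!: has_derivative_minus simp: frechet_derivative_works)
  then have eq: "- frechet_derivative f (at x) v = frechet_derivative (\<lambda>x. - f x) (at x) v"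
    if "x \<in> S" for x v
    using that by (metis frechet_derivative_at)
  have "Ck_on k S (\<lambda>x. frechet_derivative (\<lambda>x. - f x) (at x) v)" for v
    by (rule Ck_on_cong[OF assms(1) eq]) (use Suc in auto)
  with deriv show ?case by (auto simp: differentiable_def)
qed

lemma Ck_on_zero: "Ck_on k S (\<lambda>x. 0)"
  by (induction k) simp_all

lemma zero_in_smooth_funs: "0 \<in> smooth_funs M"
  by (auto simp: smooth_funs_def smooth_on_def comp_def Ck_on_zero)

lemma uminus_in_smooth_funs:
  assumes "smooth_manifold M" and "h \<in> smooth_funs M"
  shows "- h \<in> smooth_funs M"
proof -
  have "open (\<phi> ` U)" if "(U, \<phi>) \<in> charts M" for U \<phi>
    using that assms(1) by (auto simp: smooth_manifold_def is_chart_def)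
  then show ?thesis
    using assms(2) by (auto simp: smooth_funs_def smooth_on_def comp_def intro!: Ck_on_uminus)
qed

lemma zero_in_forms: "0 \<in> forms M k"
  by (auto simp: forms_def zero_in_smooth_funs)

lemma uminus_in_forms:
  assumes "smooth_manifold M" and "\<alpha> \<in> forms M k"
  shows "- \<alpha> \<in> forms M k"
  using assms(2) by (auto simp: forms_def uminus_in_smooth_funs[OF assms(1)])

lemma form_values_smooth:
  assumes "\<alpha> \<in> forms M k"
  shows "\<alpha> vs \<in> smooth_funs M"
  using assms zero_in_smooth_funs[of M]
  by (cases "length vs = k \<and> set vs \<subseteq> vfields M") (auto simp: forms_def)

lemma vfield_zero:
  assumes "v \<in> vfields M"
  shows "v 0 = 0"
proof -
  have "v (0 *\<^sub>R 0) = 0 *\<^sub>R v 0"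
    using assms zero_in_smooth_funs[of M] unfolding vfields_def by blast
  then show ?thesis by simp
qed

lemma vfield_uminus:
  assumes "v \<in> vfields M" and "h \<in> smooth_funs M"
  shows "v (- h) = - v h"
proof -
  have "v ((- 1) *\<^sub>R h) = (- 1) *\<^sub>R v h"
    using assms unfolding vfields_def by blast
  then show ?thesis by simp
qed

lemma ext_deriv_zero: "ext_deriv M 0 = 0"
proof
  fix vs
  have "(vs ! i) 0 = 0" if "i < length vs" "set vs \<subseteq> vfields M" for i
    using that by (intro vfield_zero[of _ M]) auto
  then show "ext_deriv M 0 vs = 0 vs" by (auto simp: ext_deriv_def)
qed

lemma ext_deriv_uminus:
  assumes "\<alpha> \<in> forms M k"
  shows "ext_deriv M (- \<alpha>) = - ext_deriv M \<alpha>"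
proof
  fix vs
  have "(vs ! i) (- \<alpha> (omit i vs)) = - (vs ! i) (\<alpha> (omit i vs))"
    if "i < length vs" "set vs \<subseteq> vfields M" for i
    using that form_values_smooth[OF assms] by (intro vfield_uminus[of _ M]) auto
  then show "ext_deriv M (- \<alpha>) vs = (- ext_deriv M \<alpha>) vs"
    by (auto simp: ext_deriv_def sum_negf)
qed


section \<open>Cochains and linear maps between their coefficients\<close>

text \<open>
  The total complex and the co-moment equations live over different coefficients. Applying this
  lemma and \<open>ce_diff_linear_image\<close> to the projections and to negation moves between them.
\<close>

lemma cochains_linear_image:
  assumes "f \<in> cochains k W" and "linear T" and "\<And>w. w \<in> W \<Longrightarrow> T w \<in> W'"
  shows "(\<lambda>Xs. T (f Xs)) \<in> cochains k W'"
proof -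
  have "linear (\<lambda>X. T (f (Xs[i := X])))" if "length Xs = k" "i < k" for Xs i
    using that assms(1) linear_compose[OF _ assms(2), of "\<lambda>X. f (Xs[i := X])"]
    by (simp add: cochains_def comp_def)
  then show ?thesis
    using assms by (auto simp: cochains_def linear_0 linear_neg)
qed

lemma cochains_Pair:
  assumes "f \<in> cochains k V" and "g \<in> cochains k W"
    and "\<And>Xs. length Xs = k \<Longrightarrow> (f Xs, g Xs) \<in> U"
  shows "(\<lambda>Xs. (f Xs, g Xs)) \<in> cochains k U"
  using assms by (auto simp: cochains_def zero_prod_def linear_iff)

lemma cochain_in: "f \<in> cochains k W \<Longrightarrow> length Xs = k \<Longrightarrow> f Xs \<in> W"
  by (simp add: cochains_def)

lemma cochain_eq_0: "f \<in> cochains k W \<Longrightarrow> length Xs \<noteq> k \<Longrightarrow> f Xs = 0"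
  by (simp add: cochains_def)

lemma cochain_values_in:
  "f \<in> cochains k W \<Longrightarrow> 0 \<in> W \<Longrightarrow> f Xs \<in> W"
  by (cases "length Xs = k") (auto simp: cochain_in cochain_eq_0)

lemma zero_in_cochains: "0 \<in> W \<Longrightarrow> 0 \<in> cochains k W"
  by (auto simp: cochains_def linear_iff)

lemma linear_uminus: "linear (uminus :: 'v::real_vector \<Rightarrow> 'v)"
  by (simp add: linear_iff)

lemma ce_diff_linear_image:
  assumes "linear T"
  shows "ce_diff br (\<lambda>Xs. T (f Xs)) Xs = T (ce_diff br f Xs)"
  using assms by (simp add: ce_diff_def linear_sum linear_cmul)

lemma ce_diff_zero: "ce_diff br 0 = 0"
  by (auto simp: ce_diff_def)

lemma ce_diff_wrong_length:
  assumes "f \<in> cochains k W" and "length Xs \<noteq> Suc k"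
  shows "ce_diff br f Xs = 0"
proof -
  have "f (br (Xs ! i) (Xs ! j) # omit i (omit j Xs)) = 0" if "j < length Xs" "i < j" for i j
    using that assms(2) by (intro cochain_eq_0[OF assms(1)]) (auto simp: omit_def)
  then show ?thesis by (simp add: ce_diff_def)
qed


section \<open>Lifting cochains of forms to cochains of observables\<close>

text \<open>
  The vector field components of a co-moment map: \<open>\<zeta>\<close> as a 1-cochain, and 0 in all other degrees.
\<close>

definition action_cochain ::
  "('g \<Rightarrow> 'm vfield) \<Rightarrow> nat \<Rightarrow> 'g list \<Rightarrow> 'm vfield" where
  "action_cochain \<zeta> k Xs = (if k = 1 \<and> length Xs = 1 then \<zeta> (hd Xs) else 0)"

definition lift_to_observables ::
  "('g \<Rightarrow> 'm vfield) \<Rightarrow> (nat \<Rightarrow> 'g list \<Rightarrow> 'm dform) \<Rightarrow> (nat \<Rightarrow> 'g list \<Rightarrow> 'm observable)" where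
  "lift_to_observables \<zeta> p = (\<lambda>k Xs. (action_cochain \<zeta> k Xs, - p k Xs))"

definition negated_form_part ::
  "(nat \<Rightarrow> 'g list \<Rightarrow> 'm observable) \<Rightarrow> (nat \<Rightarrow> 'g list \<Rightarrow> 'm dform)" where
  "negated_form_part f = (\<lambda>k Xs. - snd (f k Xs))"

lemma negated_form_part_lift: "negated_form_part (lift_to_observables \<zeta> p) = p"
  by (simp add: negated_form_part_def lift_to_observables_def)

lemma action_cochain_in_cochains:
  assumes "linear \<zeta>"
  shows "action_cochain \<zeta> k \<in> cochains k (insert 0 (range \<zeta>))"
proof -
  have "linear (\<lambda>X. action_cochain \<zeta> k (Xs[i := X]))" if "length Xs = k" "i < k" for Xs i
  proof (cases "k = 1")
    case True
    with that have "hd (Xs[i := X]) = X" for X by (cases Xs) auto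
    then show ?thesis using True that assms by (simp add: action_cochain_def)
  qed (simp add: action_cochain_def linear_iff)
  then show ?thesis by (auto simp: cochains_def action_cochain_def)
qed

lemma observables_negative_degree:
  assumes "2 \<le> k" and "k \<le> n"
  shows "observables n M \<omega> (1 - int k) = {0} \<times> forms M (n - k)"
proof -
  have "nat (int n - 1 + (1 - int k)) = n - k" using assms by simp
  then show ?thesis using assms by (simp add: observables_def)
qed

lemma lift_negated_form_part:
  assumes "f \<in> comoment_maps n M \<omega> br \<zeta>"
  shows "lift_to_observables \<zeta> (negated_form_part f) = f"
proof (intro ext)
  fix k Xs
  have fst_f1: "fst (f 1 [X]) = \<zeta> X" for X
    using assms by (simp add: comoment_maps_def)
  have "fst (f k Xs) = action_cochain \<zeta> k Xs"
  proof (cases "k \<in> {1..n} \<and> length Xs = k")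
    case False
    moreover have "f k Xs = 0"
    proof (cases "k \<in> {1..n}")
      case True
      with False show ?thesis
        using assms by (intro cochain_eq_0[of _ k]) (auto simp: comoment_maps_def)
    next
      case False
      then show ?thesis using assms by (simp add: comoment_maps_def)
    qed
    moreover have "action_cochain \<zeta> k Xs = 0"
    proof (cases "k = 1 \<and> length Xs = 1")
      case True
      \<comment> \<open>Then \<open>n = 0\<close>: there is no \<open>f\<^sub>1\<close>, and the lifting condition forces \<open>\<zeta> = 0\<close>.\<close>
      then have "f 1 = 0" using False assms by (auto simp: comoment_maps_def)
      then have "\<zeta> X = 0" for X using fst_f1[of X] by simp
      then show ?thesis by (simp add: action_cochain_def)
    qed (auto simp: action_cochain_def)
    ultimately show ?thesis by simp
  next
    case True
    have "f k \<in> cochains k (observables n M \<omega> (1 - int k))"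
      using True assms by (simp add: comoment_maps_def)
    then have in_obs: "f k Xs \<in> observables n M \<omega> (1 - int k)"
      using True by (simp add: cochain_in)
    show ?thesis
    proof (cases "k = 1")
      case True
      with \<open>k \<in> {1..n} \<and> length Xs = k\<close> obtain X where "Xs = [X]"
        by (auto simp: length_Suc_conv)
      then show ?thesis using True fst_f1 by (simp add: action_cochain_def)
    next
      case False
      then show ?thesis
        using True in_obs observables_negative_degree[of k n M \<omega>]
        by (auto simp: action_cochain_def)
    qed
  qed
  then show "lift_to_observables \<zeta> (negated_form_part f) k Xs = f k Xs"
    by (simp add: lift_to_observables_def negated_form_part_def prod_eq_iff)
qed


section \<open>Comparison of the two systems of equations\<close>

text \<open>
  The equation in component 0 of \<open>D p = g\<close> is void because \<open>p 0 = 0\<close>, and so are those in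
  components above \<open>n + 1\<close> and on lists of the wrong length.
\<close>

lemma total_diff_eq_action_cocycle_iff:
  assumes p: "p \<in> total_complex M n" and p0: "p 0 = 0"
  shows "total_diff n M br n p = action_cocycle n \<omega> \<zeta> \<longleftrightarrow>
    (\<forall>X. ext_deriv M (p 1 [X]) = contract (\<zeta> X) \<omega>) \<and>
    (\<forall>k \<in> {1..n}. \<forall>Xs. length Xs = k + 1 \<longrightarrow>
       ce_diff br (p k) Xs + ext_deriv M (p (k + 1) Xs) = action_cocycle n \<omega> \<zeta> (k + 1) Xs)"
    (is "?D \<longleftrightarrow> ?first \<and> ?rest")
proof -
  have "(- 1) ^ n * (- 1) ^ n = (1::real)"
    by (simp flip: power_mult_distrib)
  then have total_diff: "total_diff n M br n p k Xs =
      (if k = 0 then 0 else ce_diff br (p (k - 1)) Xs) + ext_deriv M (p k Xs)" for k Xs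
    by (simp add: total_diff_def)
  have at_1: "total_diff n M br n p 1 [X] = ext_deriv M (p 1 [X])" for X
    using p0 by (simp add: total_diff ce_diff_zero)
  have cocycle_1: "action_cocycle n \<omega> \<zeta> 1 [X] = contract (\<zeta> X) \<omega>" for X
    by (simp add: action_cocycle_def contract_list_def)
  show ?thesis
  proof
    assume ?D
    then have eq: "total_diff n M br n p k Xs = action_cocycle n \<omega> \<zeta> k Xs" for k Xs by simp
    have "ext_deriv M (p 1 [X]) = contract (\<zeta> X) \<omega>" for X
      using eq[of 1 "[X]"] by (simp only: at_1 cocycle_1)
    moreover have "ce_diff br (p k) Xs + ext_deriv M (p (k + 1) Xs) =
        action_cocycle n \<omega> \<zeta> (k + 1) Xs" for k Xs
      using eq[of "k + 1" Xs] by (simp add: total_diff)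
    ultimately show "?first \<and> ?rest" by blast
  next
    assume eqs: "?first \<and> ?rest"
    have cochain: "p k \<in> cochains k (forms M (n - k))" for k
      using p zero_in_cochains[OF zero_in_forms, of k M "n - k"]
      by (cases "k \<le> n") (auto simp: total_complex_def)
    have "total_diff n M br n p k Xs = action_cocycle n \<omega> \<zeta> k Xs" for k Xs
    proof (cases "k \<in> {1..n + 1} \<and> length Xs = k")
      case True
      show ?thesis
      proof (cases "k = 1")
        case True
        with \<open>k \<in> {1..n + 1} \<and> length Xs = k\<close> obtain X where "Xs = [X]"
          by (auto simp: length_Suc_conv)
        then show ?thesis using True eqs at_1 cocycle_1 by simp
      next
        case False
        define m where "m = k - 1"
        with True False have "m \<in> {1..n}" "k = m + 1" by auto
        then show ?thesis using True eqs by (simp add: total_diff)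
      qed
    next
      case False
      have "ce_diff br (p (k - 1)) Xs = 0" if "k \<noteq> 0"
      proof (cases "length Xs = k")
        case True
        then have "p (k - 1) = 0" using False p that by (auto simp: total_complex_def)
        then show ?thesis by (simp add: ce_diff_zero)
      next
        case False
        with that show ?thesis by (intro ce_diff_wrong_length[OF cochain]) simp
      qed
      moreover have "p k Xs = 0"
      proof (cases "length Xs = k")
        case True
        then have "k \<notin> {1..n + 1}" using False by blast
        then have "k = 0 \<or> k > n" by auto
        then show ?thesis using p p0 by (auto simp: total_complex_def)
      qed (simp add: cochain_eq_0[OF cochain])
      ultimately have "total_diff n M br n p k Xs = 0"
        by (simp add: total_diff ext_deriv_zero)
      moreover have "action_cocycle n \<omega> \<zeta> k Xs = 0"
        unfolding action_cocycle_def using False by (simp only: if_False)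
      ultimately show ?thesis by simp
    qed
    then show ?D by (intro ext) simp
  qed
qed

text \<open>
  The binary bracket has no sign in front of the contraction; it fits the general formula since
  \<open>-(-1)\<^sup>3 = 1\<close>.
\<close>

lemma lk_pullback_action:
  assumes "k \<in> {1..n}" and "length Xs = k + 1"
  shows "lk n \<omega> (replicate (k + 1) 0) (map (\<lambda>X. lift_to_observables \<zeta> p 1 [X]) Xs) =
    (if k = 1 then vf_bracket (\<zeta> (Xs ! 0)) (\<zeta> (Xs ! 1)) else 0, action_cocycle n \<omega> \<zeta> (k + 1) Xs)"
proof -
  have "map fst (map (\<lambda>X. lift_to_observables \<zeta> p 1 [X]) Xs) = map \<zeta> Xs"
    by (simp add: lift_to_observables_def action_cochain_def comp_def)
  then show ?thesis
    using assms
    by (auto simp: lk_def action_cocycle_def lift_to_observables_def action_cochain_def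
        comp_def sum_list_replicate)
qed

lemma ce_diff_action_cochain:
  assumes hom: "\<And>X Y. \<zeta> (br X Y) = vf_bracket (\<zeta> X) (\<zeta> Y)" and len: "length Xs = k + 1"
  shows "ce_diff br (action_cochain \<zeta> k) Xs =
    - (if k = 1 then vf_bracket (\<zeta> (Xs ! 0)) (\<zeta> (Xs ! 1)) else 0)"
proof (cases "k = 1")
  case True
  with len obtain X Y where "Xs = [X, Y]" by (auto simp: length_Suc_conv)
  with True show ?thesis
    by (simp add: ce_diff_def action_cochain_def omit_def hom)
qed (simp add: ce_diff_def action_cochain_def)

lemma morphism_equation_lift_iff:
  fixes \<zeta> :: "'g::real_vector \<Rightarrow> 'm vfield"
  assumes hom: "\<And>X Y. \<zeta> (br X Y) = vf_bracket (\<zeta> X) (\<zeta> Y)"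
    and k: "k \<in> {1..n}" and len: "length Xs = k + 1"
    and form: "p (k + 1) Xs \<in> forms M j"
  shows "ce_diff br (lift_to_observables \<zeta> p k) Xs
        + l1 M (- int k) (lift_to_observables \<zeta> p (k + 1) Xs) =
      - lk n \<omega> (replicate (k + 1) 0) (map (\<lambda>X. lift_to_observables \<zeta> p 1 [X]) Xs) \<longleftrightarrow>
    ce_diff br (p k) Xs + ext_deriv M (p (k + 1) Xs) = action_cocycle n \<omega> \<zeta> (k + 1) Xs"
proof -
  have "fst (ce_diff br (lift_to_observables \<zeta> p k) Xs) = ce_diff br (action_cochain \<zeta> k) Xs"
    using ce_diff_linear_image[OF linear_fst, of br "lift_to_observables \<zeta> p k" Xs]
    by (simp add: lift_to_observables_def)
  moreover have "snd (ce_diff br (lift_to_observables \<zeta> p k) Xs) = - ce_diff br (p k) Xs"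
    using ce_diff_linear_image[OF linear_snd, of br "lift_to_observables \<zeta> p k" Xs]
      ce_diff_linear_image[OF linear_uminus, of br "p k" Xs]
    by (simp add: lift_to_observables_def)
  ultimately have ce: "ce_diff br (lift_to_observables \<zeta> p k) Xs =
      (- (if k = 1 then vf_bracket (\<zeta> (Xs ! 0)) (\<zeta> (Xs ! 1)) else 0), - ce_diff br (p k) Xs)"
    by (simp only: prod_eq_iff ce_diff_action_cochain[OF hom len] fst_conv snd_conv)
  have l1: "l1 M (- int k) (lift_to_observables \<zeta> p (k + 1) Xs)
      = (0, - ext_deriv M (p (k + 1) Xs))"
    using k by (simp add: l1_def lift_to_observables_def ext_deriv_uminus[OF form[simplified]])
  have negate: "- a - b = - c \<longleftrightarrow> a + b = c" for a b c :: "'m dform"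
    by (simp only: diff_conv_add_uminus neg_equal_iff_equal flip: minus_add_distrib)
  show ?thesis
    unfolding ce l1 lk_pullback_action[OF k len] by (simp add: negate)
qed

text \<open>
  On the degree 1 component, the condition defining observables of degree 0 becomes the
  equation \<open>d p\<^sub>1 = g\<^sub>1\<close>.
\<close>

lemma lift_in_observables_iff:
  assumes M: "smooth_manifold M" and \<zeta>: "range \<zeta> \<subseteq> vfields M"
    and k: "k \<in> {1..n}" and len: "length Xs = k"
  shows "lift_to_observables \<zeta> p k Xs \<in> observables n M \<omega> (1 - int k) \<longleftrightarrow>
    p k Xs \<in> forms M (n - k) \<and> (k = 1 \<longrightarrow> ext_deriv M (p k Xs) = contract (\<zeta> (hd Xs)) \<omega>)"
proof -
  have neg: "- p k Xs \<in> forms M (n - k) \<longleftrightarrow> p k Xs \<in> forms M (n - k)"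
    using uminus_in_forms[OF M, of "p k Xs"] uminus_in_forms[OF M, of "- p k Xs"] by auto
  show ?thesis
  proof (cases "k = 1")
    case True
    with neg len \<zeta> show ?thesis
      by (auto simp: lift_to_observables_def action_cochain_def observables_def ext_deriv_uminus)
  next
    case False
    then have "2 \<le> k" "k \<le> n" using k by auto
    with False neg show ?thesis
      by (simp add: lift_to_observables_def action_cochain_def observables_negative_degree)
  qed
qed

text \<open>
  The morphism equations start at \<open>k = 1\<close> and so account for the components \<open>2, \<dots>, n + 1\<close> of
  \<open>D p = g\<close> only. Component 1 is hidden in the requirement that \<open>f\<^sub>1\<close> takes values in \<open>L\<^sub>0\<close>,
  whose elements are subject to \<open>d \<alpha> = - \<iota>\<^sub>v \<omega>\<close>.
\<close>

lemma lift_in_comoment_maps_iff: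
  fixes \<zeta> :: "'g::real_vector \<Rightarrow> 'm vfield"
  assumes n: "n \<ge> 1" and M: "smooth_manifold M"
    and lin: "linear \<zeta>" and \<zeta>: "range \<zeta> \<subseteq> vfields M"
    and hom: "\<And>X Y. \<zeta> (br X Y) = vf_bracket (\<zeta> X) (\<zeta> Y)"
  shows "lift_to_observables \<zeta> p \<in> comoment_maps n M \<omega> br \<zeta> \<longleftrightarrow>
    p \<in> reduced_potentials n M \<omega> br \<zeta>"
proof -
  let ?f = "lift_to_observables \<zeta> p"
  let ?supported = "\<forall>k. k \<notin> {1..n} \<longrightarrow> p k = 0"
  let ?cochains = "\<forall>k \<in> {1..n}. p k \<in> cochains k (forms M (n - k))"
  let ?first = "\<forall>X. ext_deriv M (p 1 [X]) = contract (\<zeta> X) \<omega>"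
  have supported_iff: "(\<forall>k. k \<notin> {1..n} \<longrightarrow> ?f k = 0) \<longleftrightarrow> ?supported"
    using n by (force simp: lift_to_observables_def action_cochain_def fun_eq_iff zero_prod_def)
  have "?f k \<in> cochains k (observables n M \<omega> (1 - int k)) \<longleftrightarrow>
      p k \<in> cochains k (forms M (n - k)) \<and> (k = 1 \<longrightarrow> ?first)" if k: "k \<in> {1..n}" for k
  proof
    assume f: "?f k \<in> cochains k (observables n M \<omega> (1 - int k))"
    have "p k Xs \<in> forms M (n - k)" "k = 1 \<Longrightarrow> ext_deriv M (p k Xs) = contract (\<zeta> (hd Xs)) \<omega>"
      if "length Xs = k" for Xs
      using cochain_in[OF f that] lift_in_observables_iff[OF M \<zeta> k that] by blast+
    moreover have "linear (\<lambda>y :: 'm observable. - snd y)"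
      by (simp add: linear_iff)
    from cochains_linear_image[OF f this, of UNIV] have "p k \<in> cochains k UNIV"
      by (simp add: lift_to_observables_def)
    ultimately show "p k \<in> cochains k (forms M (n - k)) \<and> (k = 1 \<longrightarrow> ?first)"
      by (auto simp: cochains_def)
  next
    assume p: "p k \<in> cochains k (forms M (n - k)) \<and> (k = 1 \<longrightarrow> ?first)"
    then have neg: "(\<lambda>Xs. - p k Xs) \<in> cochains k (forms M (n - k))"
      using cochains_linear_image[OF _ linear_uminus] uminus_in_forms[OF M] by blast
    have "(action_cochain \<zeta> k Xs, - p k Xs) \<in> observables n M \<omega> (1 - int k)"
      if len: "length Xs = k" for Xs
    proof -
      have "ext_deriv M (p k Xs) = contract (\<zeta> (hd Xs)) \<omega>" if "k = 1"
        using p that len by (auto simp: length_Suc_conv)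
      then show ?thesis
        using p len lift_in_observables_iff[OF M \<zeta> k len, of p \<omega>] cochain_in[of "p k" k]
        by (simp add: lift_to_observables_def)
    qed
    from cochains_Pair[OF action_cochain_in_cochains[OF lin] neg this]
    show "?f k \<in> cochains k (observables n M \<omega> (1 - int k))"
      by (simp add: lift_to_observables_def)
  qed
  then have cochains_iff:
    "(\<forall>k \<in> {1..n}. ?f k \<in> cochains k (observables n M \<omega> (1 - int k))) \<longleftrightarrow> ?cochains \<and> ?first"
    using n by auto
  have over_action: "fst (?f 1 [X]) = \<zeta> X" for X
    by (simp add: lift_to_observables_def action_cochain_def)
  have potentials_iff: "p \<in> total_complex M n \<and> p 0 = 0 \<longleftrightarrow> ?supported \<and> ?cochains"
  proof
    assume "?supported \<and> ?cochains"
    moreover have "(0 :: 'g list \<Rightarrow> 'm dform) \<in> cochains 0 (forms M n)"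
      by (rule zero_in_cochains[OF zero_in_forms])
    ultimately have "p i \<in> cochains i (forms M (n - i))" if "i \<le> n" for i
      using that by (cases "i = 0") auto
    with \<open>?supported \<and> ?cochains\<close> show "p \<in> total_complex M n \<and> p 0 = 0"
      by (simp add: total_complex_def)
  next
    assume p: "p \<in> total_complex M n \<and> p 0 = 0"
    have "p k = 0" if "k \<notin> {1..n}" for k
      using that p by (cases "k = 0") (auto simp: total_complex_def)
    moreover have "p k \<in> cochains k (forms M (n - k))" if "k \<in> {1..n}" for k
      using that p by (auto simp: total_complex_def)
    ultimately show "?supported \<and> ?cochains" by blast
  qed
  have p_forms: "p (k + 1) Xs \<in> forms M (n - (k + 1))" if "?supported \<and> ?cochains" for k Xs
    using that cochain_values_in[of "p (k + 1)" "k + 1" "forms M (n - (k + 1))"]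
      zero_in_forms[of M "n - (k + 1)"]
    by (cases "k + 1 \<in> {1..n}") auto
  show ?thesis
  proof (cases "?supported \<and> ?cochains")
    case True
    then have p: "p \<in> total_complex M n" "p 0 = 0" using potentials_iff by blast+
    note equation_iff =
      morphism_equation_lift_iff[where \<zeta> = \<zeta> and p = p, OF hom _ _ p_forms[OF True]]
    have equations_iff: "(\<forall>k \<in> {1..n}. \<forall>Xs. length Xs = k + 1 \<longrightarrow>
        ce_diff br (?f k) Xs + l1 M (- int k) (?f (k + 1) Xs) =
        - lk n \<omega> (replicate (k + 1) 0) (map (\<lambda>X. ?f 1 [X]) Xs)) \<longleftrightarrow>
      (\<forall>k \<in> {1..n}. \<forall>Xs. length Xs = k + 1 \<longrightarrow>
        ce_diff br (p k) Xs + ext_deriv M (p (k + 1) Xs) = action_cocycle n \<omega> \<zeta> (k + 1) Xs)"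
      by (intro ball_cong all_cong1 imp_cong refl equation_iff)
    have "?f \<in> comoment_maps n M \<omega> br \<zeta> \<longleftrightarrow> ?first \<and>
      (\<forall>k \<in> {1..n}. \<forall>Xs. length Xs = k + 1 \<longrightarrow>
         ce_diff br (p k) Xs + ext_deriv M (p (k + 1) Xs) = action_cocycle n \<omega> \<zeta> (k + 1) Xs)"
      unfolding comoment_maps_def mem_Collect_eq supported_iff cochains_iff over_action
        equations_iff
      using True by blast
    then show ?thesis
      unfolding reduced_potentials_def mem_Collect_eq total_diff_eq_action_cocycle_iff[OF p]
      using p by simp
  next
    case False
    then show ?thesis
      unfolding comoment_maps_def reduced_potentials_def mem_Collect_eq supported_iff cochains_iff
      using potentials_iff by blast
  qed
qed


section \<open>The correspondence\<close>

theorem lemma3p3: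
  fixes n :: nat
    and M :: "('m, 'e::real_normed_vector) manifold"
    and \<omega> :: "'m dform"
    and br :: "'g::real_vector \<Rightarrow> 'g \<Rightarrow> 'g"
    and \<zeta> :: "'g \<Rightarrow> 'm vfield"
  assumes "n \<ge> 1"
    and "pre_plectic n M \<omega>"
    and "fin_dim_lie_algebra br"
    and "plectic_action M \<omega> br \<zeta>"
  shows "\<exists>\<Phi>. bij_betw \<Phi> (comoment_maps n M \<omega> br \<zeta>) (reduced_potentials n M \<omega> br \<zeta>) \<and>
    (\<forall>f \<in> comoment_maps n M \<omega> br \<zeta>. \<forall>k Xs. \<Phi> f k Xs = - snd (f k Xs))"
proof (intro exI conjI)
  have iff: "lift_to_observables \<zeta> p \<in> comoment_maps n M \<omega> br \<zeta> \<longleftrightarrow>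
      p \<in> reduced_potentials n M \<omega> br \<zeta>" for p
    using assms
    by (intro lift_in_comoment_maps_iff)
      (auto simp: pre_plectic_def plectic_action_def plectic_vfields_def)
  show "bij_betw negated_form_part (comoment_maps n M \<omega> br \<zeta>) (reduced_potentials n M \<omega> br \<zeta>)"
  proof (rule bij_betw_byWitness[where f' = "lift_to_observables \<zeta>"])
    show "negated_form_part ` comoment_maps n M \<omega> br \<zeta> \<subseteq> reduced_potentials n M \<omega> br \<zeta>"
      by (auto simp: lift_negated_form_part simp flip: iff)
  qed (auto simp: lift_negated_form_part negated_form_part_lift iff)
  show "\<forall>f \<in> comoment_maps n M \<omega> br \<zeta>. \<forall>k Xs. negated_form_part f k Xs = - snd (f k Xs)"
    by (simp add: negated_form_part_def)
qed

end
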